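(* Let $R$ be a Left Duo ring. Then $R$ is Right McCoy; that is, for all nonzero polynomials $f(x), g(x) \in R[x]$ with $f(x)g(x)=0$ there exists a nonzero $r \in R$ such that $f(x)r=0$.
   Context: Rings are associative with unity, not necessarily commutative. $R[x]$ is the polynomial ring in one indeterminate $x$ that commutes with all elements of $R$. A ring $R$ is called Left Duo if every left ideal of $R$ is a two-sided ideal. A ring $R$ is called Right McCoy if, for all nonzero $f(x), g(x)\in R[x]$, $f(x)g(x)=0$ implies that there exists a nonzero $r\in R$ with $f(x)r=0$. *)

theory Defs
  imports "HOL-Algebra.Ideal" "HOL-Algebra.UnivPoly"
begin

locale left_ideal = additive_subgroup I R + ring R for I and R (structure) +
  assumes l_closed: "\<lbrakk>a \<in> I; x \<in> carrier R\<rbrakk> \<Longrightarrow> x \<otimes> a \<in> I"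

locale left_duo_ring = ring R for R (structure) +
  assumes left_ideal_is_ideal: "left_ideal I R \<Longrightarrow> ideal I R"

(* UP R makes sense for an arbitrary, possibly noncommutative, ring R: its product is the
   convolution of coefficients, in this order, so the indeterminate is central.
   The product f r with r in R is taken in UP R, with r read as a constant polynomial. *)
locale right_mccoy_ring = ring R for R (structure) +
  assumes right_mccoy:
    "\<lbrakk>f \<in> carrier (UP R); g \<in> carrier (UP R);
      f \<noteq> \<zero>\<^bsub>UP R\<^esub>; g \<noteq> \<zero>\<^bsub>UP R\<^esub>; f \<otimes>\<^bsub>UP R\<^esub> g = \<zero>\<^bsub>UP R\<^esub>\<rbrakk>
      \<Longrightarrow> \<exists>r \<in> carrier R. r \<noteq> \<zero> \<and> f \<otimes>\<^bsub>UP R\<^esub> monom (UP R) r 0 = \<zero>\<^bsub>UP R\<^esub>"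

end

theory Submission
  imports Defs
begin

text \<open>
  Let \<open>a i\<close> and \<open>b j\<close> be the coefficients of \<open>f\<close> and \<open>g\<close>, where \<open>f g = 0\<close> and \<open>g\<close> is nonzero.
  Two consequences of the left duo property are used throughout. Since \<open>R a\<close> is two-sided,
  factors can be moved to the left of \<open>a\<close> at the price of changing them: \<open>a r = r' a\<close>.
  Since \<open>{x. x y \<in> T}\<close> is a left ideal for every left ideal \<open>T\<close>, it is two-sided as well, so that
  factors can be inserted: \<open>x y \<in> T\<close> implies \<open>x r y \<in> T\<close>.

  The heart of the matter is that every \<open>b j\<close> is annihilated from the left by a power of every
  \<open>a k\<close> (lemma \<open>coeff_power_annihilates\<close>). This is shown by induction on \<open>k\<close>. Put \<open>a = a k\<close>, and
  let \<open>Z\<close> be the ideal generated by the \<open>a i\<close> with \<open>i < k\<close>. In the coefficient of \<open>x ^ (j + k)\<close>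
  of \<open>f g\<close>, the terms other than \<open>a b j\<close> either have their left factor in \<open>Z\<close> or involve some
  \<open>b l\<close> with \<open>l < j\<close>. By induction on \<open>j\<close>, a power of \<open>a\<close> therefore maps every \<open>b j\<close> to a
  combination of the \<open>b l\<close> with coefficients in \<open>Z\<close>. This is a linear system whose matrix is
  diagonal modulo \<open>Z\<close>, with powers of \<open>a\<close> on the diagonal. Gaussian elimination can be carried out
  on it without division, because \<open>u z = s u\<close> moves a multiplier \<open>u\<close> past an entry \<open>z\<close>
  (lemma \<open>elimination\<close>); it ends with equations \<open>c b j = 0\<close>, where \<open>c - a ^ N \<in> Z\<close> for some \<open>N\<close>.
  The generators of \<open>Z\<close> act nilpotently on \<open>b j\<close> by the induction hypothesis. Thus, if no power
  of \<open>a\<close> annihilated \<open>b j\<close>, then some left multiple \<open>s b j\<close> would have the same property while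
  \<open>Z s b j\<close> is \<open>a\<close>-torsion (lemma \<open>common_annihilated_multiple\<close>); but then \<open>c s b j = 0\<close> forces
  \<open>a ^ N s b j\<close> to be \<open>a\<close>-torsion, a contradiction.

  Finally, for some nonzero \<open>b j\<close>, lemma \<open>common_annihilated_multiple\<close> applied to the zero ideal
  gives a nonzero left multiple \<open>r\<close> of \<open>b j\<close> with \<open>a i r = 0\<close> for all \<open>i\<close>.
\<close>

section \<open>Left ideals of a left duo ring\<close>

context left_duo_ring
begin

lemma left_closed_is_ideal:
  assumes "I \<subseteq> carrier R" "\<zero> \<in> I"
    and add: "\<And>x y. x \<in> I \<Longrightarrow> y \<in> I \<Longrightarrow> x \<oplus> y \<in> I"
    and mult: "\<And>x r. x \<in> I \<Longrightarrow> r \<in> carrier R \<Longrightarrow> r \<otimes> x \<in> I"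
  shows "ideal I R"
proof (rule left_ideal_is_ideal)
  have neg: "\<ominus> x \<in> I" if "x \<in> I" for x
  proof -
    have "\<ominus> x = (\<ominus> \<one>) \<otimes> x" using that assms(1) by (simp add: l_minus subset_iff)
    then show ?thesis using mult[OF that, of "\<ominus> \<one>"] by simp
  qed
  have "subgroup I (add_monoid R)"
    by (rule add.subgroupI) (use assms neg in \<open>auto simp: a_inv_def\<close>)
  then show "left_ideal I R"
    by (intro left_ideal.intro additive_subgroup.intro ring_axioms left_ideal_axioms.intro)
       (use mult in auto)
qed

text \<open>The left ideal \<open>R a\<close> is two-sided, so that it contains \<open>a r\<close>.\<close>

lemma move_left:
  assumes a: "a \<in> carrier R" and r: "r \<in> carrier R"
  obtains s where "s \<in> carrier R" "a \<otimes> r = s \<otimes> a"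
proof -
  let ?I = "(\<lambda>x. x \<otimes> a) ` carrier R"
  have "ideal ?I R"
  proof (rule left_closed_is_ideal)
    show "?I \<subseteq> carrier R" using a by auto
    show "\<zero> \<in> ?I" using a by (auto intro!: image_eqI[of _ _ \<zero>])
  next
    fix x y assume "x \<in> ?I" "y \<in> ?I"
    then obtain p q where "p \<in> carrier R" "q \<in> carrier R" "x = p \<otimes> a" "y = q \<otimes> a" by auto
    then show "x \<oplus> y \<in> ?I" using a by (intro image_eqI[of _ _ "p \<oplus> q"]) (auto simp: l_distr)
  next
    fix x t assume "x \<in> ?I" and t: "t \<in> carrier R"
    then obtain p where "p \<in> carrier R" "x = p \<otimes> a" by auto
    then show "t \<otimes> x \<in> ?I" using a t by (intro image_eqI[of _ _ "t \<otimes> p"]) (auto simp: m_assoc)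
  qed
  moreover have "a \<in> ?I" using a by (intro image_eqI[of _ _ \<one>]) auto
  ultimately have "a \<otimes> r \<in> ?I" using r by (simp add: ideal.I_r_closed)
  then show thesis using that by auto
qed

lemma colon_ideal:
  assumes T: "ideal T R" and y: "y \<in> carrier R"
  shows "ideal {x \<in> carrier R. x \<otimes> y \<in> T} R"
proof -
  interpret T: ideal T R by fact
  show ?thesis
    by (rule left_closed_is_ideal) (use y in \<open>auto simp: l_distr m_assoc T.I_l_closed\<close>)
qed

text \<open>This is the absorption of factors on the right by the two-sided ideal \<open>{x. x y \<in> T}\<close>.\<close>

lemma insert_factor:
  assumes T: "ideal T R" and "x \<in> carrier R" "y \<in> carrier R" "r \<in> carrier R"
    and "x \<otimes> y \<in> T"
  shows "x \<otimes> (r \<otimes> y) \<in> T"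
  using ideal.I_r_closed[OF colon_ideal[OF T], of y x r] assms by (auto simp: m_assoc)

section \<open>Elements on which powers act as zero\<close>

text \<open>The preimage in \<open>R\<close> of the \<open>a\<close>-power torsion of the left module \<open>R / W\<close>.\<close>

definition power_torsion :: "'a \<Rightarrow> 'a set \<Rightarrow> 'a set" where
  "power_torsion a W = {x \<in> carrier R. \<exists>N::nat. a [^] N \<otimes> x \<in> W}"

lemma power_torsion_ideal:
  assumes W: "ideal W R" and a: "a \<in> carrier R"
  shows "ideal (power_torsion a W) R"
proof (rule left_closed_is_ideal)
  interpret W: ideal W R by fact
  show "power_torsion a W \<subseteq> carrier R" by (auto simp: power_torsion_def)
  show "\<zero> \<in> power_torsion a W" using a by (auto simp: power_torsion_def)
next
  interpret W: ideal W R by fact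
  fix x y assume "x \<in> power_torsion a W" "y \<in> power_torsion a W"
  then obtain M N :: nat where *: "x \<in> carrier R" "y \<in> carrier R"
      "a [^] M \<otimes> x \<in> W" "a [^] N \<otimes> y \<in> W"
    by (auto simp: power_torsion_def)
  have "a [^] (N + M) \<otimes> x = a [^] N \<otimes> (a [^] M \<otimes> x)"
    using a * by (simp add: nat_pow_mult[symmetric] m_assoc)
  moreover have "a [^] (N + M) \<otimes> y = a [^] M \<otimes> (a [^] N \<otimes> y)"
    using a * by (simp add: nat_pow_mult[symmetric] m_assoc add.commute[of N M])
  ultimately have "a [^] (N + M) \<otimes> (x \<oplus> y) \<in> W"
    using a * by (simp add: r_distr W.I_l_closed)
  then show "x \<oplus> y \<in> power_torsion a W" using * by (auto simp: power_torsion_def)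
next
  interpret W: ideal W R by fact
  fix x r assume "x \<in> power_torsion a W" and r: "r \<in> carrier R"
  then obtain N :: nat where *: "x \<in> carrier R" "a [^] N \<otimes> x \<in> W"
    by (auto simp: power_torsion_def)
  then have "a [^] N \<otimes> (r \<otimes> x) \<in> W" using insert_factor[OF W, of "a [^] N" x r] a r by simp
  then show "r \<otimes> x \<in> power_torsion a W" using * r by (auto simp: power_torsion_def)
qed

lemma power_torsion_pow_cancel:
  assumes "a \<in> carrier R" "x \<in> carrier R" "a [^] (N::nat) \<otimes> x \<in> power_torsion a W"
  shows "x \<in> power_torsion a W"
proof -
  obtain M :: nat where "a [^] M \<otimes> (a [^] N \<otimes> x) \<in> W"
    using assms by (auto simp: power_torsion_def)
  then have "a [^] (M + N) \<otimes> x \<in> W"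
    using assms by (simp add: nat_pow_mult[symmetric] m_assoc)
  then show ?thesis using assms by (auto simp: power_torsion_def)
qed

lemma power_torsion_superset:
  assumes "ideal W R"
  shows "W \<subseteq> power_torsion a W"
proof -
  interpret W: ideal W R by fact
  have "a [^] (0::nat) \<otimes> w \<in> W" if "w \<in> W" for w using that by simp
  then show ?thesis unfolding power_torsion_def by (blast intro: W.a_Hcarr)
qed

text \<open>Multiply \<open>b\<close> successively by the highest power of each \<open>a \<in> F\<close> that keeps it outside \<open>T\<close>.
  Later multiplications do not spoil earlier ones, since factors can be inserted.\<close>

lemma common_annihilated_multiple:
  assumes T: "ideal T R" and "finite F" "F \<subseteq> carrier R"
    and b: "b \<in> carrier R" "b \<notin> T"
    and pow: "\<And>a. a \<in> F \<Longrightarrow> \<exists>M::nat. a [^] M \<otimes> b \<in> T"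
  shows "\<exists>s\<in>carrier R. s \<otimes> b \<notin> T \<and> (\<forall>a\<in>F. a \<otimes> (s \<otimes> b) \<in> T)"
  using assms(2,3) pow
proof (induction F rule: finite_induct)
  case empty
  show ?case using b by (intro bexI[of _ \<one>]) auto
next
  case (insert a F)
  then obtain s where s: "s \<in> carrier R" "s \<otimes> b \<notin> T" "\<And>c. c \<in> F \<Longrightarrow> c \<otimes> (s \<otimes> b) \<in> T"
    by auto
  have a: "a \<in> carrier R" and F: "F \<subseteq> carrier R" using insert.prems by auto
  obtain M :: nat where "a [^] M \<otimes> b \<in> T" using insert.prems by auto
  then have "a [^] M \<otimes> (s \<otimes> b) \<in> T" using insert_factor[OF T, of "a [^] M" b s] a b s by simp
  then obtain p :: nat where p: "a [^] p \<otimes> (s \<otimes> b) \<in> T"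
      and least: "\<And>q. q < p \<Longrightarrow> a [^] q \<otimes> (s \<otimes> b) \<notin> T"
    using exists_least_iff[of "\<lambda>p. a [^] p \<otimes> (s \<otimes> b) \<in> T"] by blast
  have "p \<noteq> 0" using p s b by (cases p) auto
  then obtain q where q: "p = Suc q" by (cases p) auto
  let ?t = "a [^] q \<otimes> s"
  have t: "?t \<otimes> b = a [^] q \<otimes> (s \<otimes> b)" using a b s by (simp add: m_assoc)
  have "?t \<otimes> b \<notin> T" using least[of q] q t by simp
  moreover have "a \<otimes> (?t \<otimes> b) \<in> T"
  proof -
    have "a \<otimes> (?t \<otimes> b) = (a \<otimes> a [^] q) \<otimes> (s \<otimes> b)" using a b s by (simp add: t m_assoc)
    also have "\<dots> = a [^] p \<otimes> (s \<otimes> b)" using a nat_pow_Suc2[of a q] by (simp add: q)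
    finally show ?thesis using p by simp
  qed
  moreover have "c \<otimes> (?t \<otimes> b) \<in> T" if "c \<in> F" for c
    unfolding t using insert_factor[OF T, of c "s \<otimes> b" "a [^] q"] s that F a b by auto
  ultimately show ?case using a s by (intro bexI[of _ ?t]) auto
qed

section \<open>Elimination in diagonally dominated linear systems\<close>

primrec combinations :: "'a set \<Rightarrow> 'a list \<Rightarrow> 'a set" where
  "combinations Z [] = {\<zero>}"
| "combinations Z (b # bs) = {z \<otimes> b \<oplus> w | z w. z \<in> Z \<and> w \<in> combinations Z bs}"

lemma combinations_ideal:
  assumes Z: "ideal Z R" and "set bs \<subseteq> carrier R"
  shows "ideal (combinations Z bs) R"
  using assms(2)
proof (induction bs)
  case Nil
  show ?case by (simp add: zeroideal)
next
  case (Cons b bs)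
  interpret Z: ideal Z R by fact
  interpret W: ideal "combinations Z bs" R using Cons by simp
  have b: "b \<in> carrier R" using Cons.prems by simp
  note carr = Z.a_Hcarr W.a_Hcarr
  show ?case
  proof (rule left_closed_is_ideal)
    show "combinations Z (b # bs) \<subseteq> carrier R" using b by (auto simp: carr)
    show "\<zero> \<in> combinations Z (b # bs)"
      using b by (auto intro!: exI[of _ \<zero>])
  next
    fix x y assume "x \<in> combinations Z (b # bs)" "y \<in> combinations Z (b # bs)"
    then obtain z w z' w' where *: "x = z \<otimes> b \<oplus> w" "y = z' \<otimes> b \<oplus> w'" "z \<in> Z" "z' \<in> Z"
      "w \<in> combinations Z bs" "w' \<in> combinations Z bs" by auto
    then have "x \<oplus> y = (z \<oplus> z') \<otimes> b \<oplus> (w \<oplus> w')"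
      using b by (simp add: carr l_distr a_ac)
    moreover have "z \<oplus> z' \<in> Z" "w \<oplus> w' \<in> combinations Z bs" using * by auto
    ultimately show "x \<oplus> y \<in> combinations Z (b # bs)" by auto
  next
    fix x r assume "x \<in> combinations Z (b # bs)" and r: "r \<in> carrier R"
    then obtain z w where *: "x = z \<otimes> b \<oplus> w" "z \<in> Z" "w \<in> combinations Z bs" by auto
    then have "r \<otimes> x = (r \<otimes> z) \<otimes> b \<oplus> r \<otimes> w"
      using b r by (simp add: carr r_distr m_assoc)
    moreover have "r \<otimes> z \<in> Z" "r \<otimes> w \<in> combinations Z bs"
      using * r by (auto simp: Z.I_l_closed W.I_l_closed)
    ultimately show "r \<otimes> x \<in> combinations Z (b # bs)" by auto
  qed
qed

lemma mult_mem_combinations: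
  assumes Z: "ideal Z R" and "set bs \<subseteq> carrier R" "b \<in> set bs" "z \<in> Z"
  shows "z \<otimes> b \<in> combinations Z bs"
  using assms(2,3)
proof (induction bs)
  case Nil
  then show ?case by simp
next
  case (Cons c bs)
  interpret Z: ideal Z R by fact
  interpret W: ideal "combinations Z bs" R using combinations_ideal Z Cons.prems by simp
  have carr: "z \<in> carrier R" "c \<in> carrier R" "b \<in> carrier R"
    using assms(4) Cons.prems by (auto simp: Z.a_Hcarr)
  show ?case
  proof (cases "b = c")
    case True
    have "z \<otimes> b = z \<otimes> c \<oplus> \<zero>" using carr True by simp
    then show ?thesis unfolding combinations.simps using assms(4) W.zero_closed by blast
  next
    case False
    then have "z \<otimes> b \<in> combinations Z bs" using Cons by simp
    moreover have "z \<otimes> b = \<zero> \<otimes> c \<oplus> z \<otimes> b" using carr by simp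
    ultimately show ?thesis unfolding combinations.simps using Z.zero_closed by blast
  qed
qed

text \<open>One elimination step removes the head \<open>b\<close> of the list. Its own equation \<open>c b = z b + w\<close>
  gives the multiplier \<open>u = c - z\<close> with \<open>u b = w\<close>. In the equation \<open>c y = z b + w\<close> of another
  element, multiplication by \<open>u\<close> turns \<open>z b\<close> into \<open>u z b = s u b\<close>, which is a combination of the
  remaining elements. The elements \<open>y\<close> range over a set larger than the list, as the eliminated
  ones are kept as left-hand sides.\<close>

lemma elimination:
  assumes Z: "ideal Z R" and S: "S \<subseteq> carrier R"
    and S_mult: "\<And>c d. c \<in> S \<Longrightarrow> d \<in> S \<Longrightarrow> c \<otimes> d \<in> S"
    and S_diff: "\<And>c z. c \<in> S \<Longrightarrow> z \<in> Z \<Longrightarrow> c \<ominus> z \<in> S"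
    and "set bs \<subseteq> Y" "Y \<subseteq> carrier R"
    and "\<And>y. y \<in> Y \<Longrightarrow> \<exists>c\<in>S. c \<otimes> y \<in> combinations Z bs"
    and "y \<in> Y"
  shows "\<exists>c\<in>S. c \<otimes> y = \<zero>"
  using assms(5-8)
proof (induction bs arbitrary: y)
  case Nil
  then show ?case by auto
next
  case (Cons b bs)
  interpret Z: ideal Z R by fact
  have bs: "set bs \<subseteq> carrier R" and b: "b \<in> carrier R" using Cons.prems by auto
  interpret W: ideal "combinations Z bs" R using combinations_ideal[OF Z bs] .
  obtain c\<^sub>0 z\<^sub>0 w\<^sub>0 where 0: "c\<^sub>0 \<in> S" "z\<^sub>0 \<in> Z" "w\<^sub>0 \<in> combinations Z bs" "c\<^sub>0 \<otimes> b = z\<^sub>0 \<otimes> b \<oplus> w\<^sub>0"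
    using Cons.prems(3)[of b] Cons.prems(1) by auto
  define u where "u = c\<^sub>0 \<ominus> z\<^sub>0"
  have carr0: "c\<^sub>0 \<in> carrier R" "z\<^sub>0 \<in> carrier R" "w\<^sub>0 \<in> carrier R"
    using 0 S by (auto simp: Z.a_Hcarr W.a_Hcarr)
  have uS: "u \<in> S" and u: "u \<in> carrier R" using S_diff[OF 0(1,2)] S by (auto simp: u_def)
  have "u \<otimes> b = (z\<^sub>0 \<otimes> b \<oplus> w\<^sub>0) \<ominus> z\<^sub>0 \<otimes> b"
    using carr0 b by (simp add: u_def minus_eq l_distr l_minus 0(4))
  also have "\<dots> = w\<^sub>0"
    using carr0 b by algebra
  finally have ub: "u \<otimes> b \<in> combinations Z bs" using 0 by simp
  show ?case
  proof (rule Cons.IH)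
    show "set bs \<subseteq> Y" "Y \<subseteq> carrier R" "y \<in> Y" using Cons.prems by auto
  next
    fix x assume x: "x \<in> Y"
    obtain c z w where *: "c \<in> S" "z \<in> Z" "w \<in> combinations Z bs" "c \<otimes> x = z \<otimes> b \<oplus> w"
      using Cons.prems(3)[OF x] by auto
    have carr: "c \<in> carrier R" "z \<in> carrier R" "w \<in> carrier R" "x \<in> carrier R"
      using * S x Cons.prems by (auto simp: Z.a_Hcarr W.a_Hcarr)
    obtain s where s: "s \<in> carrier R" "u \<otimes> z = s \<otimes> u" using move_left u carr by blast
    have "(u \<otimes> c) \<otimes> x = u \<otimes> (z \<otimes> b \<oplus> w)" using u carr *(4) by (simp add: m_assoc)
    also have "\<dots> = (u \<otimes> z) \<otimes> b \<oplus> u \<otimes> w" using u carr b by (simp add: r_distr m_assoc)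
    also have "\<dots> = s \<otimes> (u \<otimes> b) \<oplus> u \<otimes> w" using u carr b s by (simp add: m_assoc)
    finally have "(u \<otimes> c) \<otimes> x \<in> combinations Z bs"
      using ub s(1) u *(3) by (simp add: W.I_l_closed)
    then show "\<exists>c\<in>S. c \<otimes> x \<in> combinations Z bs" using S_mult[OF uS *(1)] by blast
  qed
qed

section \<open>Coefficients of annihilating polynomials\<close>

lemma summand_mem_ideal:
  assumes V: "ideal V R" and F: "finite F" "k \<in> F" and h: "\<And>i. i \<in> F \<Longrightarrow> h i \<in> carrier R"
    and sum: "(\<Oplus>i\<in>F. h i) \<in> V" and rest: "\<And>i. i \<in> F \<Longrightarrow> i \<noteq> k \<Longrightarrow> h i \<in> V"
  shows "h k \<in> V"
proof -
  interpret V: ideal V R by fact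
  have part: "(\<Oplus>i\<in>G. h i) \<in> V" if "finite G" "G \<subseteq> F - {k}" for G
    using that
  proof (induction G rule: finite_induct)
    case (insert i G)
    then show ?case using rest by (subst finsum_insert) (use h in auto)
  qed simp
  define t where "t = (\<Oplus>i\<in>F - {k}. h i)"
  have t: "t \<in> V" using part[of "F - {k}"] F by (simp add: t_def)
  have "(\<Oplus>i\<in>F. h i) = (\<Oplus>i\<in>insert k (F - {k}). h i)" using F by (simp add: insert_absorb)
  also have "\<dots> = h k \<oplus> t" unfolding t_def by (rule finsum_insert) (use F h in auto)
  finally have "(\<Oplus>i\<in>F. h i) = h k \<oplus> t" .
  then have "h k = (\<Oplus>i\<in>F. h i) \<ominus> t"
    using t h[OF F(2)] V.a_Hcarr[OF t] by (simp add: minus_eq a_assoc r_neg)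
  then show ?thesis using sum t by (simp add: minus_eq)
qed

text \<open>The sequences are the coefficients of two polynomials with product zero, \<open>n\<close> bounding the
  degree of the second. The case \<open>k\<close> rests on the smaller ones, because the \<open>a i\<close> with \<open>i < k\<close>
  are the ones that couple \<open>a k \<otimes> b j\<close> to coefficients \<open>b l\<close> with \<open>l > j\<close>.\<close>

lemma coeff_power_annihilates:
  fixes a b :: "nat \<Rightarrow> 'a"
  assumes a: "\<And>i. a i \<in> carrier R" and b: "\<And>j. b j \<in> carrier R"
    and b_above: "\<And>j. n < j \<Longrightarrow> b j = \<zero>"
    and conv: "\<And>m. (\<Oplus>i\<in>{..m}. a i \<otimes> b (m - i)) = \<zero>"
  shows "b j \<in> power_torsion (a k) {\<zero>}"
proof (induction k arbitrary: j rule: less_induct)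
  case (less k)
  note [simp] = a b
  define Z where "Z = Idl (a ` {..<k})"
  define bs where "bs = map b [0..<Suc n]"
  define W where "W = combinations Z bs"
  define T where "T = power_torsion (a k) {\<zero>}"
  have gens: "a ` {..<k} \<subseteq> carrier R" by auto
  have Z: "ideal Z R" unfolding Z_def by (rule genideal_ideal[OF gens])
  have bs: "set bs \<subseteq> carrier R" by (auto simp: bs_def)
  have W: "ideal W R" unfolding W_def by (rule combinations_ideal[OF Z bs])
  have T: "ideal T R" unfolding T_def by (rule power_torsion_ideal[OF zeroideal a])
  interpret Z: ideal Z R by fact
  interpret W: ideal W R by fact
  interpret T: ideal T R by fact
  have aZ: "a i \<in> Z" if "i < k" for i
    unfolding Z_def using genideal_self[OF gens] that by auto
  have aW: "a i \<otimes> b l \<in> W" if "i < k" for i l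
  proof (cases "l \<le> n")
    case True
    then have "b l \<in> set bs" by (simp add: bs_def del: upt_Suc)
    then show ?thesis unfolding W_def using mult_mem_combinations Z bs aZ[OF that] by simp
  next
    case False
    then show ?thesis using b_above[of l] by simp
  qed

  \<comment> \<open>In the coefficient of \<open>x ^ (l + k)\<close>, the terms with \<open>i < k\<close> lie in \<open>W\<close>, and those with
    \<open>i > k\<close> contain a coefficient of smaller index than \<open>l\<close>.\<close>
  have b_mod_W: "b l \<in> power_torsion (a k) W" for l
  proof (induction l rule: less_induct)
    case (less l)
    let ?V = "power_torsion (a k) W"
    interpret V: ideal ?V R by (rule power_torsion_ideal[OF W a])
    have "a k \<otimes> b (l + k - k) \<in> ?V"
    proof (rule summand_mem_ideal[where F = "{..l + k}" and h = "\<lambda>i. a i \<otimes> b (l + k - i)"])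
      show "(\<Oplus>i\<in>{..l + k}. a i \<otimes> b (l + k - i)) \<in> ?V" by (simp add: conv)
    next
      fix i assume i: "i \<in> {..l + k}" "i \<noteq> k"
      show "a i \<otimes> b (l + k - i) \<in> ?V"
      proof (cases "i < k")
        case True
        then show ?thesis using aW power_torsion_superset[OF W] by blast
      next
        case False
        then have "b (l + k - i) \<in> ?V" using i by (intro less.IH) auto
        then show ?thesis by (simp add: V.I_l_closed)
      qed
    qed (use V.ideal_axioms in auto)
    then have "a k [^] (1::nat) \<otimes> b l \<in> ?V" by simp
    then show ?case by (rule power_torsion_pow_cancel[rotated 2]) auto
  qed

  \<comment> \<open>The admissible multipliers of the elimination: powers of \<open>a k\<close> modulo \<open>Z\<close>.\<close>
  define S where "S = {c \<in> carrier R. \<exists>N::nat. c \<ominus> a k [^] N \<in> Z}"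
  have "\<exists>c\<in>S. c \<otimes> b j = \<zero>"
  proof (rule elimination[where Y = "range b"])
    show "ideal Z R" by fact
    show "S \<subseteq> carrier R" by (auto simp: S_def)
    show "set bs \<subseteq> range b" "range b \<subseteq> carrier R" by (auto simp: bs_def)
    show "b j \<in> range b" by simp
  next
    fix c d assume "c \<in> S" "d \<in> S"
    then obtain M N :: nat where *: "c \<in> carrier R" "d \<in> carrier R"
        "c \<ominus> a k [^] M \<in> Z" "d \<ominus> a k [^] N \<in> Z"
      by (auto simp: S_def)
    have "c \<otimes> d \<ominus> a k [^] (M + N) = c \<otimes> d \<ominus> a k [^] M \<otimes> a k [^] N"
      by (simp add: nat_pow_mult)
    also have "\<dots> = (c \<ominus> a k [^] M) \<otimes> d \<oplus> a k [^] M \<otimes> (d \<ominus> a k [^] N)"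
    proof -
      have "x \<otimes> y \<ominus> p \<otimes> q = (x \<ominus> p) \<otimes> y \<oplus> p \<otimes> (y \<ominus> q)"
        if "x \<in> carrier R" "y \<in> carrier R" "p \<in> carrier R" "q \<in> carrier R" for x y p q
        using that by algebra
      from this[OF *(1,2)] show ?thesis by simp
    qed
    also have "\<dots> \<in> Z" using * by (simp add: Z.I_l_closed Z.I_r_closed)
    finally show "c \<otimes> d \<in> S" using * by (auto simp: S_def)
  next
    fix c z assume "c \<in> S" and z: "z \<in> Z"
    then obtain N :: nat where *: "c \<in> carrier R" "c \<ominus> a k [^] N \<in> Z" by (auto simp: S_def)
    have "(c \<ominus> z) \<ominus> a k [^] N = (c \<ominus> a k [^] N) \<oplus> (\<ominus> z)"
      using * Z.a_Hcarr[OF z] by (simp add: minus_eq a_ac)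
    also have "\<dots> \<in> Z" using * z by simp
    finally show "c \<ominus> z \<in> S" using * Z.a_Hcarr[OF z] by (auto simp: S_def)
  next
    fix y assume "y \<in> range b"
    then obtain l where y: "y = b l" by auto
    obtain N :: nat where "a k [^] N \<otimes> b l \<in> W"
      using b_mod_W[of l] by (auto simp: power_torsion_def)
    moreover have "a k [^] N \<in> S" by (auto simp: S_def minus_eq r_neg intro!: exI[of _ N])
    ultimately show "\<exists>c\<in>S. c \<otimes> y \<in> combinations Z bs" unfolding y W_def by blast
  qed
  then obtain c and N :: nat where c: "c \<in> carrier R" "c \<ominus> a k [^] N \<in> Z" "c \<otimes> b j = \<zero>"
    by (auto simp: S_def)

  \<comment> \<open>On a suitable left multiple of \<open>b j\<close>, the ideal \<open>Z\<close> acts as zero modulo \<open>T\<close>, so that \<open>c\<close>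
    acts there like a power of \<open>a k\<close>, which is injective modulo \<open>T\<close>.\<close>
  have "b j \<in> T"
  proof (rule ccontr)
    assume "b j \<notin> T"
    obtain s where s: "s \<in> carrier R" "s \<otimes> b j \<notin> T"
      and kill: "\<And>i. i < k \<Longrightarrow> a i \<otimes> (s \<otimes> b j) \<in> T"
    proof -
      have "\<exists>M::nat. x [^] M \<otimes> b j \<in> T" if x: "x \<in> a ` {..<k}" for x
      proof -
        obtain i where "i < k" "x = a i" using x by auto
        then obtain M :: nat where "x [^] M \<otimes> b j = \<zero>"
          using less.IH[of i j] by (auto simp: power_torsion_def)
        then have "x [^] M \<otimes> b j \<in> T" by simp
        then show ?thesis ..
      qed
      then have "\<exists>s\<in>carrier R. s \<otimes> b j \<notin> T \<and> (\<forall>x\<in>a ` {..<k}. x \<otimes> (s \<otimes> b j) \<in> T)"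
        by (intro common_annihilated_multiple[OF T _ gens b \<open>b j \<notin> T\<close>]) simp_all
      then show thesis using that by blast
    qed
    let ?y = "s \<otimes> b j"
    have y: "?y \<in> carrier R" using s by simp
    have "Z \<subseteq> {x \<in> carrier R. x \<otimes> ?y \<in> T}"
      unfolding Z_def by (rule genideal_minimal[OF colon_ideal[OF T y]]) (auto simp: kill)
    then have "(c \<ominus> a k [^] N) \<otimes> ?y \<in> T" using c(2) by blast
    moreover have "c \<otimes> ?y \<in> T"
      using insert_factor[OF T, of c "b j" s] c s by simp
    moreover have "a k [^] N \<otimes> ?y = c \<otimes> ?y \<ominus> (c \<ominus> a k [^] N) \<otimes> ?y"
    proof -
      have "p \<otimes> x = q \<otimes> x \<ominus> (q \<ominus> p) \<otimes> x"
        if "x \<in> carrier R" "q \<in> carrier R" "p \<in> carrier R" for x q p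
        using that by algebra
      from this[OF y c(1)] show ?thesis by simp
    qed
    ultimately have "a k [^] N \<otimes> ?y \<in> T" by (simp add: minus_eq)
    then have "?y \<in> T" unfolding T_def by (rule power_torsion_pow_cancel[rotated 2]) (use y in auto)
    then show False using s by simp
  qed
  then show ?case by (simp add: T_def)
qed

end

theorem theorem1:
  fixes R :: "('a, 'm) ring_scheme" (structure)
  assumes "left_duo_ring R"
  shows "right_mccoy_ring R"
proof -
  interpret left_duo_ring R by fact
  interpret UP: UP_ring R "UP R" by unfold_locales
  show ?thesis
  proof
    fix f g
    assume f: "f \<in> carrier (UP R)" and g: "g \<in> carrier (UP R)"
      and g0: "g \<noteq> \<zero>\<^bsub>UP R\<^esub>" and fg: "f \<otimes>\<^bsub>UP R\<^esub> g = \<zero>\<^bsub>UP R\<^esub>"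
    define a where "a = coeff (UP R) f"
    define b where "b = coeff (UP R) g"
    have a: "a i \<in> carrier R" and b: "b i \<in> carrier R" for i
      using f g by (simp_all add: a_def b_def)
    have torsion: "b j \<in> power_torsion (a k) {\<zero>}" for j k
    proof (rule coeff_power_annihilates)
      show "b l = \<zero>" if "deg R g < l" for l
        using UP.deg_aboveD[OF that g] by (simp add: b_def)
      show "(\<Oplus>i\<in>{..m}. a i \<otimes> b (m - i)) = \<zero>" for m
        using UP.coeff_mult[OF f g, of m] fg by (simp add: a_def b_def)
    qed (fact a b)+
    obtain j where j: "b j \<noteq> \<zero>"
      using g0 UP.up_eqI[OF _ g UP.UP_zero_closed] by (auto simp: b_def)
    have "\<exists>s\<in>carrier R. s \<otimes> b j \<notin> {\<zero>} \<and> (\<forall>x\<in>a ` {..deg R f}. x \<otimes> (s \<otimes> b j) \<in> {\<zero>})"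
      by (rule common_annihilated_multiple[OF zeroideal])
         (use a b j torsion in \<open>auto simp: power_torsion_def\<close>)
    then obtain s where s: "s \<in> carrier R" "s \<otimes> b j \<noteq> \<zero>"
      and kill: "\<And>i. i \<le> deg R f \<Longrightarrow> a i \<otimes> (s \<otimes> b j) = \<zero>" by auto
    define r where "r = s \<otimes> b j"
    have r: "r \<in> carrier R" using s b by (simp add: r_def)
    have ar: "a i \<otimes> r = \<zero>" for i
    proof (cases "i \<le> deg R f")
      case True
      then show ?thesis using kill by (simp add: r_def)
    next
      case False
      then have "a i = \<zero>" using UP.deg_aboveD[OF _ f] by (simp add: a_def)
      then show ?thesis using r by simp
    qed
    have "f \<otimes>\<^bsub>UP R\<^esub> monom (UP R) r 0 = \<zero>\<^bsub>UP R\<^esub>"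
    proof (rule UP.up_eqI)
      fix m
      have "a i \<otimes> coeff (UP R) (monom (UP R) r 0) (m - i) = \<zero>" for i
        using ar[of i] a[of i] r by simp
      then show "coeff (UP R) (f \<otimes>\<^bsub>UP R\<^esub> monom (UP R) r 0) m = coeff (UP R) \<zero>\<^bsub>UP R\<^esub> m"
        using f r by (simp add: a_def finsum_zero del: UP.coeff_monom)
    qed (use f r in simp_all)
    then show "\<exists>r\<in>carrier R. r \<noteq> \<zero> \<and> f \<otimes>\<^bsub>UP R\<^esub> monom (UP R) r 0 = \<zero>\<^bsub>UP R\<^esub>"
      using r s by (auto simp: r_def)
  qed
qed

end
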